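(* Let $d\in\mathbb{N}_0\cup\{\infty\}$ and let $L\in\mathbb{R}[\underline X]_{2d+2}^*$ be a linear form with $L(p^2)\ge 0$ for all $p\in\mathbb{R}[\underline X]_{d+1}$. The following assertions are equivalent: (1) The truncated GNS multiplication operators $M_{L,1},\dots,M_{L,n}$ pairwise commute. (2) There exists $\hat L\in\mathbb{R}[\underline X]_{2d+2}^*$ with $\hat L(p^2)\ge 0$ for all $p\in\mathbb{R}[\underline X]_{d+1}$ such that $L=\hat L$ on $\mathbb{R}[\underline X]_{2d+1}$ and $\hat L$ is flat.
   Context: $n\in\mathbb{N}$, $\underline X=(X_1,\dots,X_n)$; $\mathbb{R}[\underline X]_k$ is the space of real polynomials of degree at most $k$, $\mathbb{R}[\underline X]_\infty:=\mathbb{R}[\underline X]$ (and $d+1=2d+1=2d+2=\infty$ if $d=\infty$); $*$ denotes the dual space. For a linear form $L\in\mathbb{R}[\underline X]_{2d+2}^*$ with $L(p^2)\ge0$ for all $p\in\mathbb{R}[\underline X]_{d+1}$: - the truncated GNS kernel is $U_L:=\{p\in\mathbb{R}[\underline X]_{d+1}: L(pq)=0\text{ for all }q\in\mathbb{R}[\underline X]_{d+1}\}$; - the GNS representation space is $V_L:=\mathbb{R}[\underline X]_{d+1}/U_L$, with classes written $\overline p^L$ and inner product $\langle\overline p^L,\overline q^L\rangle_L:=L(pq)$; - the GNS truncation is the subspace $T_L:=\{\overline p^L: p\in\mathbb{R}[\underline X]_d\}\subseteq V_L$, and $\Pi_L$ is the orthogonal projection of $V_L$ onto $T_L$; - the $i$-th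 truncated GNS multiplication operator is $M_{L,i}:T_L\to T_L$, $\overline p^L\mapsto\Pi_L(\overline{X_ip}^L)$ for $p\in\mathbb{R}[\underline X]_d$ ($i=1,\dots,n$); it is a well-defined self-adjoint endomorphism; - $L$ is called flat if $\mathbb{R}[\underline X]_{d+1}=\mathbb{R}[\underline X]_d+U_L$ (equivalently $T_L=V_L$). *)

theory Defs
  imports
    Complex_Main
    "HOL-Library.Poly_Mapping"
    "HOL-Library.Extended_Nat"
    "HOL-Library.Set_Algebras"
begin

text \<open>
  Real polynomials in the variables \<open>X\<^sub>i\<close>, with \<open>i\<close> ranging over the finite index type \<open>'n\<close>
  (so the number of variables is \<open>CARD('n)\<close>): finitely supported maps from exponent vectors to
  coefficients, with the convolution product supplied by \<open>Poly_Mapping\<close>.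
\<close>

type_synonym 'n rpoly = "('n \<Rightarrow>\<^sub>0 nat) \<Rightarrow>\<^sub>0 real"

definition pvar :: "'n \<Rightarrow> 'n rpoly"
  where "pvar i = Poly_Mapping.single (Poly_Mapping.single i 1) 1"

definition pconst :: "real \<Rightarrow> 'n rpoly"
  where "pconst c = Poly_Mapping.single 0 c"

definition mon_degree :: "('n::finite \<Rightarrow>\<^sub>0 nat) \<Rightarrow> nat"
  where "mon_degree m = (\<Sum>i\<in>UNIV. Poly_Mapping.lookup m i)"

text \<open>Polynomials of total degree at most \<open>k\<close>; the case \<open>k = \<infinity>\<close> gives all polynomials, and the
  zero polynomial has degree at most \<open>k\<close> for every \<open>k\<close>.\<close>

definition polys_le :: "enat \<Rightarrow> ('n::finite) rpoly set"
  where "polys_le k = {p. \<forall>m\<in>Poly_Mapping.keys p. enat (mon_degree m) \<le> k}"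

text \<open>Elements of the dual of \<open>polys_le k\<close> are represented by total functions that are linear on
  \<open>polys_le k\<close>; their values at polynomials of larger degree are irrelevant.\<close>

definition linear_form_on :: "enat \<Rightarrow> (('n::finite) rpoly \<Rightarrow> real) \<Rightarrow> bool"
  where "linear_form_on k L \<longleftrightarrow>
    (\<forall>p\<in>polys_le k. \<forall>q\<in>polys_le k. L (p + q) = L p + L q) \<and>
    (\<forall>c. \<forall>p\<in>polys_le k. L (pconst c * p) = c * L p)"

definition gns_kernel :: "enat \<Rightarrow> (('n::finite) rpoly \<Rightarrow> real) \<Rightarrow> 'n rpoly set"
  where "gns_kernel d L = {p \<in> polys_le (d + 1). \<forall>q\<in>polys_le (d + 1). L (p * q) = 0}"

text \<open>The quotient space consists of the cosets \<open>p +o gns_kernel d L\<close>.  Addition of cosets is the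
  elementwise addition of sets from \<open>Set_Algebras\<close>.\<close>

definition gns_class :: "enat \<Rightarrow> (('n::finite) rpoly \<Rightarrow> real) \<Rightarrow> 'n rpoly \<Rightarrow> 'n rpoly set"
  where "gns_class d L p = p +o gns_kernel d L"

definition gns_space :: "enat \<Rightarrow> (('n::finite) rpoly \<Rightarrow> real) \<Rightarrow> 'n rpoly set set"
  where "gns_space d L = gns_class d L ` polys_le (d + 1)"

definition gns_inner ::
    "enat \<Rightarrow> (('n::finite) rpoly \<Rightarrow> real) \<Rightarrow> 'n rpoly set \<Rightarrow> 'n rpoly set \<Rightarrow> real"
  where "gns_inner d L u v =
    (THE r. \<exists>p\<in>polys_le (d + 1). \<exists>q\<in>polys_le (d + 1).
       u = gns_class d L p \<and> v = gns_class d L q \<and> r = L (p * q))"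

definition gns_trunc :: "enat \<Rightarrow> (('n::finite) rpoly \<Rightarrow> real) \<Rightarrow> 'n rpoly set set"
  where "gns_trunc d L = gns_class d L ` polys_le d"

text \<open>Orthogonal projection onto the truncation: the component in \<open>gns_trunc d L\<close> of the
  decomposition into the truncation and its orthogonal complement.  The truncation is
  finite-dimensional for finite \<open>d\<close> and is the whole space for \<open>d = \<infinity>\<close>, so the decomposition
  always exists.\<close>

definition gns_proj :: "enat \<Rightarrow> (('n::finite) rpoly \<Rightarrow> real) \<Rightarrow> 'n rpoly set \<Rightarrow> 'n rpoly set"
  where "gns_proj d L v =
    (THE t. t \<in> gns_trunc d L \<and>
       (\<exists>w\<in>gns_space d L. (\<forall>s\<in>gns_trunc d L. gns_inner d L w s = 0) \<and> v = t + w))"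

definition gns_mult ::
    "enat \<Rightarrow> (('n::finite) rpoly \<Rightarrow> real) \<Rightarrow> 'n \<Rightarrow> 'n rpoly set \<Rightarrow> 'n rpoly set"
  where "gns_mult d L i t =
    (THE t'. \<exists>p\<in>polys_le d. t = gns_class d L p \<and> t' = gns_proj d L (gns_class d L (pvar i * p)))"

definition flat_form :: "enat \<Rightarrow> (('n::finite) rpoly \<Rightarrow> real) \<Rightarrow> bool"
  where "flat_form d L \<longleftrightarrow> polys_le (d + 1) = polys_le d + gns_kernel d L"

end

theory Submission
  imports Defs "HOL-Library.Multiset"
begin

text \<open>
  Write \<open>R\<^sub>k\<close> for the polynomials of degree at most \<open>k\<close>, and
  \<open>\<langle>p, q\<rangle> = L (p * q)\<close> for the positive semidefinite form on \<open>R\<^sub>d\<^sub>+\<^sub>1\<close> behind the GNS space.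
  A vector of \<open>R\<^sub>d\<close> orthogonal to \<open>R\<^sub>d\<close> has length zero, so by Cauchy--Schwarz it is orthogonal to
  all of \<open>R\<^sub>d\<^sub>+\<^sub>1\<close>.  Hence a class in the truncation is determined by its inner products with
  \<open>R\<^sub>d\<close>, and the operator \<open>M\<^sub>i\<close> is described by a representative \<open>mult_rep i p \<in> R\<^sub>d\<close> of
  \<open>M\<^sub>i p\<close>: the one that has the same inner products with \<open>R\<^sub>d\<close> as \<open>X\<^sub>i p\<close>.
  Since the operators are self-adjoint, they commute exactly if
  \<open>\<langle>M\<^sub>i p, M\<^sub>j q\<rangle> = \<langle>M\<^sub>j p, M\<^sub>i q\<rangle>\<close> for all \<open>p\<close> and \<open>q\<close> in \<open>R\<^sub>d\<close> (\<open>gns_mult_commute_iff\<close>).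

  If \<open>L'\<close> is a flat extension of the values of \<open>L\<close> on \<open>R\<^sub>2\<^sub>d\<^sub>+\<^sub>1\<close>, then \<open>X\<^sub>i p\<close> is congruent modulo
  the kernel of \<open>L'\<close> to some polynomial in \<open>R\<^sub>d\<close>, and that polynomial represents \<open>M\<^sub>i p\<close>, because
  the inner products between \<open>R\<^sub>d\<^sub>+\<^sub>1\<close> and \<open>R\<^sub>d\<close> are the same for both forms.  So
  \<open>\<langle>M\<^sub>i p, M\<^sub>j q\<rangle> = L' (X\<^sub>i X\<^sub>j p q)\<close>, which is symmetric in \<open>i\<close> and \<open>j\<close>
  (\<open>commuting_if_flat_extension\<close>).

  Conversely, commuting operators can be substituted into polynomials, and
  \<open>L' p = \<langle>p(M) 1, 1\<rangle>\<close> is the required form.  It satisfies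
  \<open>L' (p * q) = \<langle>p(M) 1, q(M) 1\<rangle>\<close> (\<open>functional_rep_mult\<close>), whence it is positive semidefinite.
  An induction on monomials shows that \<open>p(M) 1\<close> is the orthogonal projection of \<open>p\<close> for every
  \<open>p \<in> R\<^sub>d\<^sub>+\<^sub>1\<close> (\<open>functional_rep_project\<close>).  Splitting a monomial of degree at most \<open>2d + 1\<close> into
  factors of degrees at most \<open>d + 1\<close> and \<open>d\<close> then gives \<open>L' = L\<close> on \<open>R\<^sub>2\<^sub>d\<^sub>+\<^sub>1\<close>
  (\<open>functional_rep_extends\<close>), and \<open>L'\<close> is flat because a polynomial of degree \<open>d + 1\<close> differs from
  a representative of its projection by a polynomial \<open>u\<close> with \<open>u(M) 1 = 0\<close>
  (\<open>flat_functional_rep\<close>).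

  The argument also covers infinite \<open>d\<close>, where the projection is the identity.
\<close>

section \<open>Polynomials of bounded degree\<close>

text \<open>
  A linear statement about the polynomials with monomials in \<open>S\<close> reduces to single monomials.  The
  set \<open>S\<close> is kept in the induction so that it covers degree bounds and finite sets of monomials alike.
\<close>

lemma polynomial_support_induct [consumes 1, case_names zero monomial add]:
  fixes p :: "'a \<Rightarrow>\<^sub>0 'b::comm_monoid_add"
  assumes "Poly_Mapping.keys p \<subseteq> S"
    and "P 0"
    and "\<And>m c. m \<in> S \<Longrightarrow> P (Poly_Mapping.single m c)"
    and "\<And>p q. \<lbrakk>Poly_Mapping.keys p \<subseteq> S; Poly_Mapping.keys q \<subseteq> S; P p; P q\<rbrakk> \<Longrightarrow> P (p + q)"
  shows "P p"
proof -
  have "Poly_Mapping.keys (\<Sum>m\<in>A. Poly_Mapping.single m (Poly_Mapping.lookup p m)) \<subseteq> S \<and>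
        P (\<Sum>m\<in>A. Poly_Mapping.single m (Poly_Mapping.lookup p m))"
    if "finite A" "A \<subseteq> S" for A
    using that
  proof (induction A rule: finite_induct)
    case (insert m A)
    have "Poly_Mapping.keys (Poly_Mapping.single m (Poly_Mapping.lookup p m)) \<subseteq> S"
      using insert.prems by simp
    then show ?case
      using insert assms(3,4) by (auto dest!: set_mp[OF keys_add])
  qed (use assms(2) in simp)
  moreover have "p = (\<Sum>m\<in>Poly_Mapping.keys p. Poly_Mapping.single m (Poly_Mapping.lookup p m))"
    by (rule poly_mapping_eqI) (simp add: lookup_sum lookup_single when_def sum.delta in_keys_iff)
  ultimately show ?thesis
    using assms(1) by (metis finite_keys)
qed

lemma keys_diff_subset:
  fixes p q :: "'a \<Rightarrow>\<^sub>0 'b::ab_group_add"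
  shows "Poly_Mapping.keys (p - q) \<subseteq> Poly_Mapping.keys p \<union> Poly_Mapping.keys q"
  by (auto simp: in_keys_iff lookup_minus)

lemma keys_pconst_mult: "Poly_Mapping.keys (pconst c * p) \<subseteq> Poly_Mapping.keys p"
  using keys_mult[of "pconst c" p] by (auto simp: pconst_def split: if_splits)

lemma pconst_add: "pconst (a + b) = pconst a + pconst b"
  by (simp add: pconst_def single_add)

lemma pconst_mult: "pconst a * pconst b = pconst (a * b)"
  by (simp add: pconst_def mult_single)

lemma pconst_0 [simp]: "pconst 0 = 0"
  by (simp add: pconst_def)

lemma single_eq_pconst_mult: "Poly_Mapping.single m c = pconst c * Poly_Mapping.single m 1"
  by (simp add: pconst_def mult_single)

lemma lookup_pconst_mult [simp]:
  "Poly_Mapping.lookup (pconst c * p) m = c * Poly_Mapping.lookup p m"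
proof -
  have "pconst c * p = Poly_Mapping.map ((*) c) p"
    by (simp add: mult_map_scale_conv_mult pconst_def)
  then show ?thesis
    by (simp add: Poly_Mapping.map.rep_eq when_def)
qed

lemma mon_degree_add: "mon_degree (m + m') = mon_degree m + mon_degree m'"
  by (simp add: mon_degree_def lookup_add sum.distrib)

lemma mon_degree_0 [simp]: "mon_degree 0 = 0"
  by (simp add: mon_degree_def)

lemma mon_degree_single [simp]: "mon_degree (Poly_Mapping.single i k) = k"
  by (simp add: mon_degree_def lookup_single when_def)

lemma polys_le_iff: "p \<in> polys_le k \<longleftrightarrow> Poly_Mapping.keys p \<subseteq> {m. enat (mon_degree m) \<le> k}"
  by (auto simp: polys_le_def)

lemma polys_le_0 [simp]: "0 \<in> polys_le k"
  by (simp add: polys_le_def)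

lemma polys_le_1 [simp]: "1 \<in> polys_le k"
  by (simp add: polys_le_def flip: zero_enat_def)

lemma polys_le_add: "p \<in> polys_le k \<Longrightarrow> q \<in> polys_le k \<Longrightarrow> p + q \<in> polys_le k"
  using keys_add[of p q] unfolding polys_le_iff by blast

lemma polys_le_diff: "p \<in> polys_le k \<Longrightarrow> q \<in> polys_le k \<Longrightarrow> p - q \<in> polys_le k"
  using keys_diff_subset[of p q] unfolding polys_le_iff by blast

lemma polys_le_pconst_mult: "p \<in> polys_le k \<Longrightarrow> pconst c * p \<in> polys_le k"
  using keys_pconst_mult[of c p] unfolding polys_le_iff by blast

lemma polys_le_single: "enat (mon_degree m) \<le> k \<Longrightarrow> Poly_Mapping.single m c \<in> polys_le k"
  by (simp add: polys_le_def)

lemma polys_le_mono: "k \<le> l \<Longrightarrow> p \<in> polys_le k \<Longrightarrow> p \<in> polys_le l"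
  by (auto simp: polys_le_def intro: order_trans)

lemma polys_le_mult:
  assumes "p \<in> polys_le k" "q \<in> polys_le l"
  shows "p * q \<in> polys_le (k + l)"
proof -
  have "enat (mon_degree (a + b)) \<le> k + l"
    if "enat (mon_degree a) \<le> k" "enat (mon_degree b) \<le> l" for a b :: "'a \<Rightarrow>\<^sub>0 nat"
    using add_mono[OF that] by (simp add: mon_degree_add)
  then show ?thesis
    using assms keys_mult[of p q] unfolding polys_le_iff by fastforce
qed

lemma polys_le_pvar: "pvar i \<in> polys_le 1"
  by (simp add: pvar_def polys_le_def one_enat_def)

lemma polys_le_pvar_mult: "p \<in> polys_le k \<Longrightarrow> pvar i * p \<in> polys_le (k + 1)"
  using polys_le_mult[OF polys_le_pvar, of p k i] by (simp add: add.commute)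

lemma polys_le_mult_Suc:
  assumes "p \<in> polys_le (d + 1)" "q \<in> polys_le (d + 1)"
  shows "p * q \<in> polys_le (2 * d + 2)"
  using polys_le_mult[OF assms] by (simp add: distrib_right add_ac flip: one_add_one)

lemma polys_le_Suc: "p \<in> polys_le k \<Longrightarrow> p \<in> polys_le (k + 1)"
  by (rule polys_le_mono) simp_all

section \<open>Monomials as words in the variables\<close>

text \<open>
  Applying the operators to \<open>1\<close> one after the other depends a priori on their order, so it is indexed
  by lists of variables.  Each list stands for the monomial that is the product of its entries, and two
  lists give the same monomial exactly if they are permutations of each other.
\<close>

definition word_exponent :: "'n list \<Rightarrow> ('n \<Rightarrow>\<^sub>0 nat)"
  where "word_exponent xs = (\<Sum>i\<leftarrow>xs. Poly_Mapping.single i 1)"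

lemma lookup_word_exponent: "Poly_Mapping.lookup (word_exponent xs) i = count (mset xs) i"
  by (induction xs) (auto simp: word_exponent_def lookup_add lookup_single when_def)

lemma word_exponent_eq_iff: "word_exponent xs = word_exponent ys \<longleftrightarrow> mset xs = mset ys"
  by (simp add: poly_mapping_eq_iff fun_eq_iff multiset_eq_iff lookup_word_exponent)

lemma word_exponent_append: "word_exponent (xs @ ys) = word_exponent xs + word_exponent ys"
  by (simp add: word_exponent_def)

lemma word_exponent_rev: "word_exponent (rev xs) = word_exponent xs"
  by (simp add: word_exponent_eq_iff)

lemma mon_degree_word_exponent [simp]: "mon_degree (word_exponent xs) = length xs"
  by (induction xs) (auto simp: word_exponent_def mon_degree_add)

lemma ex_word_exponent: "\<exists>xs. word_exponent xs = (m :: 'n::finite \<Rightarrow>\<^sub>0 nat)"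
proof -
  obtain xs where "mset xs = Abs_multiset (Poly_Mapping.lookup m)"
    using ex_mset by blast
  then have "word_exponent xs = m"
    by (intro poly_mapping_eqI) (simp add: lookup_word_exponent count_Abs_multiset)
  then show ?thesis ..
qed

lemma prod_pvar_word: "(\<Prod>i\<leftarrow>xs. pvar i) = Poly_Mapping.single (word_exponent xs) 1"
  by (induction xs) (auto simp: word_exponent_def pvar_def mult_single)

lemma finite_mon_degree_le: "finite {m :: 'n::finite \<Rightarrow>\<^sub>0 nat. mon_degree m \<le> k}"
proof (rule finite_subset)
  show "{m :: 'n \<Rightarrow>\<^sub>0 nat. mon_degree m \<le> k}
      \<subseteq> word_exponent ` {xs. set xs \<subseteq> UNIV \<and> length xs \<le> k}"
  proof
    fix m :: "'n \<Rightarrow>\<^sub>0 nat" assume "m \<in> {m. mon_degree m \<le> k}"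
    moreover obtain xs where "word_exponent xs = m"
      using ex_word_exponent by blast
    ultimately show "m \<in> word_exponent ` {xs. set xs \<subseteq> UNIV \<and> length xs \<le> k}"
      by (intro image_eqI[of _ _ xs]) auto
  qed
qed (simp only: finite_imageI finite_lists_length_le finite_UNIV)

section \<open>Positive semidefinite linear forms\<close>

text \<open>
  The form is required to be additive and homogeneous on all polynomials, not only up to degree
  \<open>2d + 2\<close>.  This spares degree side conditions in every linear computation, and
  \<open>ex_linear_extension\<close> below shows that it is no loss of generality.
\<close>

locale psd_linear_form =
  fixes d :: enat and L :: "('n::finite) rpoly \<Rightarrow> real"
  assumes L_add: "L (p + q) = L p + L q"
    and L_scale: "L (pconst c * p) = c * L p"
    and L_psd: "p \<in> polys_le (d + 1) \<Longrightarrow> L (p\<^sup>2) \<ge> 0"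
begin

lemma L_0 [simp]: "L 0 = 0"
  using L_add[of 0 0] by simp

lemma L_diff: "L (p - q) = L p - L q"
  using L_add[of "p - q" q] by simp

lemma L_scale_left: "L (pconst c * p * q) = c * L (p * q)"
  and L_scale_right: "L (p * (pconst c * q)) = c * L (p * q)"
  using L_scale[of c "p * q"] by (simp_all add: mult_ac)

text \<open>
  This is the degenerate case of the Cauchy--Schwarz inequality: if \<open>L (p * p) = 0\<close>, then
  \<open>L ((t p + q)\<^sup>2) = 2 t L (p * q) + L (q * q)\<close> is affine in \<open>t\<close> and nonnegative, hence constant.
\<close>

lemma null_vector_orthogonal:
  assumes "p \<in> polys_le (d + 1)" "L (p * p) = 0" "q \<in> polys_le (d + 1)"
  shows "L (p * q) = 0"
proof (rule ccontr)
  assume nz: "L (p * q) \<noteq> 0"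
  \<comment> \<open>At this \<open>t\<close> the affine function has the value \<open>-1\<close>.\<close>
  define t where "t = - (L (q * q) + 1) / (2 * L (p * q))"
  have "0 \<le> L ((pconst t * p + q)\<^sup>2)"
    by (intro L_psd polys_le_add polys_le_pconst_mult assms)
  also have "(pconst t * p + q)\<^sup>2
      = pconst (t * t) * (p * p) + (pconst t * (p * q) + pconst t * (p * q)) + q * q"
    by (simp add: power2_eq_square distrib_left distrib_right mult_ac add_ac flip: pconst_mult)
  also have "L \<dots> = 2 * t * L (p * q) + L (q * q)"
    using assms(2) by (simp only: L_add L_scale)
  also have "\<dots> = - 1"
    using nz by (simp add: t_def field_simps)
  finally show False
    by simp
qed

text \<open>
  A polynomial in \<open>R\<^sub>d\<close> may be tested against itself, so orthogonality to \<open>R\<^sub>d\<close> makes it a null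
  vector.  Thus equality of classes in the truncation can be checked on \<open>R\<^sub>d\<close>, where only values of
  \<open>L\<close> up to degree \<open>2d\<close> enter.
\<close>

lemma orthogonal_in_gns_kernel:
  assumes "p \<in> polys_le d" "\<And>q. q \<in> polys_le d \<Longrightarrow> L (p * q) = 0"
  shows "p \<in> gns_kernel d L"
  using assms null_vector_orthogonal[of p] by (auto simp: gns_kernel_def polys_le_Suc)

lemma gns_kernelD: "p \<in> gns_kernel d L \<Longrightarrow> q \<in> polys_le (d + 1) \<Longrightarrow> L (p * q) = 0"
  by (simp add: gns_kernel_def)

section \<open>Orthogonal projection onto the truncation\<close>

text \<open>
  This is the Gram--Schmidt process, adding one monomial to \<open>S\<close> at a time.  As the form is only
  semidefinite, the component \<open>e\<close> of the new monomial orthogonal to the old ones may be a null vector;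
  it is then orthogonal to everything, and the old projection remains valid.
\<close>

lemma ex_projection_finite_support:
  assumes "finite S" "\<And>m. m \<in> S \<Longrightarrow> enat (mon_degree m) \<le> d + 1" "p \<in> polys_le (d + 1)"
  shows "\<exists>r. Poly_Mapping.keys r \<subseteq> S \<and> (\<forall>q. Poly_Mapping.keys q \<subseteq> S \<longrightarrow> L ((p - r) * q) = 0)"
  using assms
proof (induction S arbitrary: p rule: finite_induct)
  case empty
  show ?case
    by (rule exI[of _ 0]) simp
next
  case (insert m S)
  define a :: "'n rpoly" where "a = Poly_Mapping.single m 1"
  have deg: "r \<in> polys_le (d + 1)" if "Poly_Mapping.keys r \<subseteq> insert m S" for r
    using that insert.prems(1) unfolding polys_le_iff by blast
  have a: "a \<in> polys_le (d + 1)"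
    by (rule deg) (simp add: a_def)
  obtain r where r: "Poly_Mapping.keys r \<subseteq> S"
      "\<And>q. Poly_Mapping.keys q \<subseteq> S \<Longrightarrow> L ((p - r) * q) = 0"
    using insert.IH[of p] insert.prems by auto
  obtain b where b: "Poly_Mapping.keys b \<subseteq> S"
      "\<And>q. Poly_Mapping.keys q \<subseteq> S \<Longrightarrow> L ((a - b) * q) = 0"
    using insert.IH[of a] insert.prems a by auto
  \<comment> \<open>The part of the new monomial orthogonal to \<open>S\<close>, and the coefficient of \<open>p\<close> along it.\<close>
  define e where "e = a - b"
  define t where "t = (if L (e * e) = 0 then 0 else L ((p - r) * e) / L (e * e))"
  define r' where "r' = r + pconst t * e"
  have e: "Poly_Mapping.keys e \<subseteq> insert m S"
    using keys_diff_subset[of a b] b(1) by (auto simp: e_def a_def)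
  have r': "Poly_Mapping.keys r' \<subseteq> insert m S"
    using keys_add[of r "pconst t * e"] keys_pconst_mult[of t e] r(1) e by (auto simp: r'_def)
  have orth_S: "L ((p - r') * q) = 0" if "Poly_Mapping.keys q \<subseteq> S" for q
  proof -
    have "L ((p - r') * q) = L ((p - r) * q) - t * L (e * q)"
      by (simp add: r'_def left_diff_distrib distrib_right L_add L_diff L_scale_left)
    then show ?thesis
      using that r(2) b(2) by (simp add: e_def)
  qed
  have orth_e: "L ((p - r') * e) = 0"
  proof (cases "L (e * e) = 0")
    case True
    have "p - r' \<in> polys_le (d + 1)"
      using insert.prems(2) deg[OF r'] by (rule polys_le_diff)
    then have "L (e * (p - r')) = 0"
      using null_vector_orthogonal[OF deg[OF e] True] by blast
    then show ?thesis
      by (simp add: mult.commute)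
  next
    case False
    have "L ((p - r') * e) = L ((p - r) * e) - t * L (e * e)"
      by (simp add: r'_def left_diff_distrib distrib_right L_add L_diff L_scale_left)
    then show ?thesis
      using False by (simp add: t_def)
  qed
  have orth_a: "L ((p - r') * a) = 0"
    using orth_e orth_S[OF b(1)] by (simp add: e_def right_diff_distrib L_diff)
  have "L ((p - r') * q) = 0" if "Poly_Mapping.keys q \<subseteq> insert m S" for q
    using that
  proof (induction q rule: polynomial_support_induct)
    case (monomial m' c)
    show ?case
    proof (cases "m' = m")
      case True
      then show ?thesis
        using orth_a single_eq_pconst_mult[of m c]
        by (simp add: a_def L_scale_right)
    next
      case False
      then show ?thesis
        using monomial by (intro orth_S) auto
    qed
  qed (simp_all add: distrib_left L_add)
  then show ?case
    using r' by blast
qed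

lemma ex_projection:
  assumes "p \<in> polys_le (d + 1)"
  shows "\<exists>r\<in>polys_le d. \<forall>q\<in>polys_le d. L ((p - r) * q) = 0"
proof (cases d)
  case (enat k)
  define S :: "('n \<Rightarrow>\<^sub>0 nat) set" where "S = {m. enat (mon_degree m) \<le> d}"
  have "finite S"
    using finite_mon_degree_le[of k] by (simp add: S_def enat)
  moreover have "enat (mon_degree m) \<le> d + 1" if "m \<in> S" for m
    using order_trans[of "enat (mon_degree m)" d "d + 1"] that by (simp add: S_def)
  ultimately obtain r where "Poly_Mapping.keys r \<subseteq> S"
      "\<And>q. Poly_Mapping.keys q \<subseteq> S \<Longrightarrow> L ((p - r) * q) = 0"
    using ex_projection_finite_support[of S p] assms by auto
  then show ?thesis
    by (intro bexI[of _ r]) (simp_all add: polys_le_iff S_def)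
next
  case infinity
  then show ?thesis
    using assms by (intro bexI[of _ p]) simp_all
qed

section \<open>The multiplication operators on representatives\<close>

text \<open>
  Only the class of this polynomial modulo the kernel is determined.  A representative rather than the
  class is chosen because polynomials can be multiplied and linearly combined directly.
\<close>

definition mult_rep :: "'n \<Rightarrow> 'n rpoly \<Rightarrow> 'n rpoly"
  where "mult_rep i p = (SOME r. r \<in> polys_le d \<and> (\<forall>q\<in>polys_le d. L ((pvar i * p - r) * q) = 0))"

lemma
  assumes "p \<in> polys_le d"
  shows mult_rep_polys_le: "mult_rep i p \<in> polys_le d"
    and mult_rep_inner: "q \<in> polys_le d \<Longrightarrow> L (mult_rep i p * q) = L (pvar i * p * q)"
proof -
  have "mult_rep i p \<in> polys_le d \<and> (\<forall>q\<in>polys_le d. L ((pvar i * p - mult_rep i p) * q) = 0)"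
    unfolding mult_rep_def
    by (rule someI_ex) (use ex_projection[OF polys_le_pvar_mult[OF assms, of i]] in blast)
  then show "mult_rep i p \<in> polys_le d"
    "q \<in> polys_le d \<Longrightarrow> L (mult_rep i p * q) = L (pvar i * p * q)"
    by (auto simp: left_diff_distrib L_diff)
qed

lemma mult_rep_selfadjoint:
  assumes "p \<in> polys_le d" "q \<in> polys_le d"
  shows "L (mult_rep i p * q) = L (p * mult_rep i q)"
  using mult_rep_inner[OF assms, of i] mult_rep_inner[OF assms(2,1), of i] by (simp add: mult_ac)

text \<open>
  In terms of the GNS space this reads \<open>\<langle>M\<^sub>i p, M\<^sub>j q\<rangle> = \<langle>M\<^sub>j p, M\<^sub>i q\<rangle>\<close>; for self-adjoint operators it says
  that \<open>M\<^sub>j M\<^sub>i p\<close> and \<open>M\<^sub>i M\<^sub>j p\<close> have equal inner products with every \<open>q\<close>.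
\<close>

definition commuting :: bool
  where "commuting \<longleftrightarrow> (\<forall>i j. \<forall>p\<in>polys_le d. \<forall>q\<in>polys_le d.
    L (mult_rep i p * mult_rep j q) = L (mult_rep j p * mult_rep i q))"

lemma gns_class_eq_iff: "gns_class d L p = gns_class d L q \<longleftrightarrow> p - q \<in> gns_kernel d L"
proof -
  have 0: "0 \<in> gns_kernel d L"
    by (simp add: gns_kernel_def)
  have diff: "a - b \<in> gns_kernel d L" if "a \<in> gns_kernel d L" "b \<in> gns_kernel d L" for a b
    using that by (simp add: gns_kernel_def polys_le_diff left_diff_distrib L_diff)
  show ?thesis
  proof
    assume "gns_class d L p = gns_class d L q"
    moreover have "p \<in> gns_class d L p"
      using 0 by (auto simp: gns_class_def elt_set_plus_def)
    ultimately show "p - q \<in> gns_kernel d L"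
      by (auto simp: gns_class_def elt_set_plus_def)
  next
    assume *: "p - q \<in> gns_kernel d L"
    have sub: "x +o gns_kernel d L \<subseteq> y +o gns_kernel d L" if "y - x \<in> gns_kernel d L" for x y
    proof
      fix z assume "z \<in> x +o gns_kernel d L"
      then obtain u where "u \<in> gns_kernel d L" "z = x + u"
        by (auto simp: elt_set_plus_def)
      then show "z \<in> y +o gns_kernel d L"
        using diff[of u "y - x"] that set_plus_intro2[of "u - (y - x)" "gns_kernel d L" y]
        by (simp add: add.commute[of u x])
    qed
    have "q - p \<in> gns_kernel d L"
      using diff[OF 0 *] by simp
    then show "gns_class d L p = gns_class d L q"
      using * sub unfolding gns_class_def by blast
  qed
qed

lemma gns_class_add: "gns_class d L p + gns_class d L q = gns_class d L (p + q)"
proof -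
  have sum: "a + b \<in> gns_kernel d L" if "a \<in> gns_kernel d L" "b \<in> gns_kernel d L" for a b
    using that by (simp add: gns_kernel_def polys_le_add distrib_right L_add)
  have 0: "0 \<in> gns_kernel d L"
    by (simp add: gns_kernel_def)
  have "gns_kernel d L + gns_kernel d L = gns_kernel d L"
    using sum 0 by (force simp: set_plus_def)
  then show ?thesis
    by (simp add: gns_class_def set_plus_rearrange)
qed

lemma gns_inner_class:
  assumes "p \<in> polys_le (d + 1)" "q \<in> polys_le (d + 1)"
  shows "gns_inner d L (gns_class d L p) (gns_class d L q) = L (p * q)"
  unfolding gns_inner_def
proof (rule the_equality)
  fix r
  assume "\<exists>p'\<in>polys_le (d + 1). \<exists>q'\<in>polys_le (d + 1).
    gns_class d L p = gns_class d L p' \<and> gns_class d L q = gns_class d L q' \<and> r = L (p' * q')"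
  then obtain p' q' where *: "p' \<in> polys_le (d + 1)" "q' \<in> polys_le (d + 1)"
      "p - p' \<in> gns_kernel d L" "q - q' \<in> gns_kernel d L" "r = L (p' * q')"
    by (auto simp: gns_class_eq_iff)
  have "L ((p - p') * q) = 0" "L ((q - q') * p') = 0"
    using * assms by (auto intro: gns_kernelD)
  then show "r = L (p * q)"
    using *(5) by (simp add: left_diff_distrib right_diff_distrib L_diff mult.commute)
qed (use assms in blast)

lemma gns_class_eqI:
  assumes "p \<in> polys_le d" "q \<in> polys_le d" "\<And>s. s \<in> polys_le d \<Longrightarrow> L (p * s) = L (q * s)"
  shows "gns_class d L p = gns_class d L q"
  unfolding gns_class_eq_iff
  using assms by (intro orthogonal_in_gns_kernel polys_le_diff) (auto simp: left_diff_distrib L_diff)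

text \<open>
  Any representative in \<open>R\<^sub>d\<close> with an error term orthogonal to \<open>R\<^sub>d\<close> computes the projection, since
  two such representatives differ by an element of \<open>R\<^sub>d\<close> orthogonal to \<open>R\<^sub>d\<close>.
\<close>

lemma gns_proj_class:
  assumes "p \<in> polys_le (d + 1)" "r \<in> polys_le d"
    and orth: "\<And>q. q \<in> polys_le d \<Longrightarrow> L ((p - r) * q) = 0"
  shows "gns_proj d L (gns_class d L p) = gns_class d L r"
  unfolding gns_proj_def
proof (rule the_equality)
  have "gns_class d L (p - r) \<in> gns_space d L"
    using assms(1) polys_le_Suc[OF assms(2)] by (auto simp: gns_space_def intro: polys_le_diff)
  moreover have "\<forall>s\<in>gns_trunc d L. gns_inner d L (gns_class d L (p - r)) s = 0"
    using assms by (auto simp: gns_trunc_def gns_inner_class polys_le_diff polys_le_Suc)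
  moreover have "gns_class d L p = gns_class d L r + gns_class d L (p - r)"
    by (simp add: gns_class_add)
  ultimately show "gns_class d L r \<in> gns_trunc d L \<and> (\<exists>w\<in>gns_space d L.
      (\<forall>s\<in>gns_trunc d L. gns_inner d L w s = 0) \<and> gns_class d L p = gns_class d L r + w)"
    using assms(2) by (auto simp: gns_trunc_def)
next
  fix t
  assume "t \<in> gns_trunc d L \<and> (\<exists>w\<in>gns_space d L.
      (\<forall>s\<in>gns_trunc d L. gns_inner d L w s = 0) \<and> gns_class d L p = t + w)"
  then obtain r' u where *: "r' \<in> polys_le d" "t = gns_class d L r'" "u \<in> polys_le (d + 1)"
      "\<And>q. q \<in> polys_le d \<Longrightarrow> gns_inner d L (gns_class d L u) (gns_class d L q) = 0"
      "gns_class d L p = gns_class d L r' + gns_class d L u"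
    by (auto simp: gns_trunc_def gns_space_def)
  have ker: "p - (r' + u) \<in> gns_kernel d L"
    using *(5) by (simp add: gns_class_add gns_class_eq_iff)
  show "t = gns_class d L r"
    unfolding *(2)
  proof (rule gns_class_eqI[OF *(1) assms(2)])
    fix q :: "'n rpoly" assume q: "q \<in> polys_le d"
    have "L (u * q) = 0"
      using *(3,4) q by (simp add: gns_inner_class polys_le_Suc)
    moreover have "L ((p - (r' + u)) * q) = 0"
      using ker q by (intro gns_kernelD polys_le_Suc)
    ultimately show "L (r' * q) = L (r * q)"
      using orth[OF q] by (simp add: algebra_simps L_diff L_add)
  qed
qed

lemma gns_mult_class:
  assumes "p \<in> polys_le d"
  shows "gns_mult d L i (gns_class d L p) = gns_class d L (mult_rep i p)"
proof -
  have proj: "gns_proj d L (gns_class d L (pvar i * p')) = gns_class d L (mult_rep i p')"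
    if "p' \<in> polys_le d" for p'
    using that by (intro gns_proj_class polys_le_pvar_mult mult_rep_polys_le)
      (simp_all add: left_diff_distrib L_diff mult_rep_inner)
  \<comment> \<open>Multiplication by \<open>X\<^sub>i\<close> can be moved to the test vector \<open>s\<close>, and \<open>X\<^sub>i s\<close> is still in \<open>R\<^sub>d\<^sub>+\<^sub>1\<close>,
    where kernel elements vanish; so the operator does not depend on the representative.\<close>
  have indep: "gns_class d L (mult_rep i p') = gns_class d L (mult_rep i p)"
    if "p' \<in> polys_le d" "gns_class d L p = gns_class d L p'" for p'
  proof (rule gns_class_eqI)
    fix s :: "'n rpoly" assume s: "s \<in> polys_le d"
    have "L ((p - p') * (pvar i * s)) = 0"
      using that s by (intro gns_kernelD polys_le_pvar_mult) (simp_all add: gns_class_eq_iff)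
    then have "L (pvar i * p' * s) = L (pvar i * p * s)"
      by (simp add: algebra_simps L_diff)
    then show "L (mult_rep i p' * s) = L (mult_rep i p * s)"
      using s that assms by (simp add: mult_rep_inner)
  qed (use that assms in \<open>simp_all add: mult_rep_polys_le\<close>)
  show ?thesis
    unfolding gns_mult_def
  proof (rule the_equality)
    show "\<exists>p'\<in>polys_le d. gns_class d L p = gns_class d L p' \<and>
        gns_class d L (mult_rep i p) = gns_proj d L (gns_class d L (pvar i * p'))"
      using assms proj[OF assms] by (intro bexI[of _ p]) simp_all
  next
    fix t
    assume "\<exists>p'\<in>polys_le d. gns_class d L p = gns_class d L p' \<and>
        t = gns_proj d L (gns_class d L (pvar i * p'))"
    then show "t = gns_class d L (mult_rep i p)"
      using indep proj by blast
  qed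
qed

lemma gns_mult_commute_iff:
  "(\<forall>i j. \<forall>t\<in>gns_trunc d L. gns_mult d L i (gns_mult d L j t) = gns_mult d L j (gns_mult d L i t))
    \<longleftrightarrow> commuting"
proof -
  have pointwise:
    "gns_class d L (mult_rep i (mult_rep j p)) = gns_class d L (mult_rep j (mult_rep i p))
      \<longleftrightarrow> (\<forall>q\<in>polys_le d. L (mult_rep i p * mult_rep j q) = L (mult_rep j p * mult_rep i q))"
    if p: "p \<in> polys_le d" for i j p
  proof -
    have adj: "L (mult_rep i (mult_rep j p) * q) = L (mult_rep j p * mult_rep i q)"
      if "q \<in> polys_le d" for i j q
      using p that by (simp add: mult_rep_selfadjoint mult_rep_polys_le)
    have "gns_class d L (mult_rep i (mult_rep j p)) = gns_class d L (mult_rep j (mult_rep i p))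
      \<longleftrightarrow> (\<forall>q\<in>polys_le d.
            L (mult_rep i (mult_rep j p) * q) = L (mult_rep j (mult_rep i p) * q))"
    proof
      assume "gns_class d L (mult_rep i (mult_rep j p)) = gns_class d L (mult_rep j (mult_rep i p))"
      then have "mult_rep i (mult_rep j p) - mult_rep j (mult_rep i p) \<in> gns_kernel d L"
        by (simp add: gns_class_eq_iff)
      then show "\<forall>q\<in>polys_le d.
            L (mult_rep i (mult_rep j p) * q) = L (mult_rep j (mult_rep i p) * q)"
        by (auto dest: gns_kernelD[OF _ polys_le_Suc] simp: left_diff_distrib L_diff)
    next
      assume "\<forall>q\<in>polys_le d.
            L (mult_rep i (mult_rep j p) * q) = L (mult_rep j (mult_rep i p) * q)"
      then show "gns_class d L (mult_rep i (mult_rep j p)) = gns_class d L (mult_rep j (mult_rep i p))"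
        using p by (intro gns_class_eqI mult_rep_polys_le) simp_all
    qed
    then show ?thesis
      by (auto simp: adj)
  qed
  have pair: "(\<forall>t\<in>gns_trunc d L. gns_mult d L i (gns_mult d L j t) = gns_mult d L j (gns_mult d L i t))
      \<longleftrightarrow> (\<forall>p\<in>polys_le d. \<forall>q\<in>polys_le d.
            L (mult_rep i p * mult_rep j q) = L (mult_rep j p * mult_rep i q))" for i j
  proof -
    have "(\<forall>t\<in>gns_trunc d L. gns_mult d L i (gns_mult d L j t) = gns_mult d L j (gns_mult d L i t))
        \<longleftrightarrow> (\<forall>p\<in>polys_le d. gns_class d L (mult_rep i (mult_rep j p))
                           = gns_class d L (mult_rep j (mult_rep i p)))"
      by (simp add: gns_trunc_def gns_mult_class mult_rep_polys_le)
    also have "\<dots> \<longleftrightarrow> (\<forall>p\<in>polys_le d. \<forall>q\<in>polys_le d.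
            L (mult_rep i p * mult_rep j q) = L (mult_rep j p * mult_rep i q))"
      by (rule ball_cong[OF refl pointwise])
    finally show ?thesis .
  qed
  show ?thesis
    unfolding commuting_def by (rule iff_allI, rule iff_allI, rule pair)
qed

section \<open>A flat extension from commuting operators\<close>

text \<open>
  A representative of the vector obtained from the class of \<open>1\<close> by applying the operators named in the
  list, the last entry first.
\<close>

fun word_rep :: "'n list \<Rightarrow> 'n rpoly"
  where "word_rep [] = 1"
  | "word_rep (i # xs) = mult_rep i (word_rep xs)"

lemma word_rep_polys_le: "word_rep xs \<in> polys_le d"
  by (induction xs) (simp_all add: mult_rep_polys_le)

text \<open>
  Up to degree \<open>d\<close> the operators multiply monomials without loss, so that the word represents the
  monomial itself; only the last multiplication, into degree \<open>d + 1\<close>, projects.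
\<close>

lemma word_rep_project:
  assumes "enat (length xs) \<le> d + 1" "q \<in> polys_le d"
  shows "L (word_rep xs * q) = L ((\<Prod>i\<leftarrow>xs. pvar i) * q)"
  using assms
proof (induction xs arbitrary: q)
  case (Cons i xs)
  have len: "enat (length xs) \<le> d"
    using Cons.prems(1) by (cases d) (auto simp: one_enat_def)
  have "(\<Prod>i\<leftarrow>xs. pvar i) \<in> polys_le d"
    using len by (simp add: prod_pvar_word polys_le_single)
  moreover have "L (word_rep xs * s) = L ((\<Prod>i\<leftarrow>xs. pvar i) * s)" if "s \<in> polys_le d" for s
    using Cons.IH[OF _ that] len order_trans[of "enat (length xs)" d "d + 1"] by simp
  \<comment> \<open>Below degree \<open>d + 1\<close> the projection property means equality modulo the kernel.\<close>
  ultimately have ker: "word_rep xs - (\<Prod>i\<leftarrow>xs. pvar i) \<in> gns_kernel d L"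
    by (intro orthogonal_in_gns_kernel polys_le_diff word_rep_polys_le)
       (simp_all add: left_diff_distrib L_diff)
  have "L ((word_rep xs - (\<Prod>i\<leftarrow>xs. pvar i)) * (pvar i * q)) = 0"
    using ker Cons.prems(2) by (intro gns_kernelD polys_le_pvar_mult)
  then have "L (pvar i * word_rep xs * q) = L (pvar i * (\<Prod>i\<leftarrow>xs. pvar i) * q)"
    by (simp add: algebra_simps L_diff)
  moreover have "L (word_rep (i # xs) * q) = L (pvar i * word_rep xs * q)"
    using mult_rep_inner[OF word_rep_polys_le Cons.prems(2), of i xs] by simp
  ultimately show ?case
    by simp
next
  case Nil
  show ?case
    by simp
qed

text \<open>
  Moving the operators of \<open>xs\<close> to the other side of the inner product, one by one, reverses their order.
\<close>

lemma word_rep_append: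
  "L (word_rep (xs @ ys)) = L (word_rep (rev xs) * word_rep ys)"
proof (induction xs arbitrary: ys rule: rev_induct)
  case (snoc x xs)
  have "L (word_rep ((xs @ [x]) @ ys)) = L (word_rep (rev xs) * mult_rep x (word_rep ys))"
    using snoc.IH[of "x # ys"] by simp
  also have "\<dots> = L (mult_rep x (word_rep (rev xs)) * word_rep ys)"
    by (rule mult_rep_selfadjoint[symmetric]; rule word_rep_polys_le)
  finally show ?case
    by simp
qed simp

text \<open>
  The exchange condition lets an operator move past its neighbour: \<open>x\<close> is already in front by induction,
  and self-adjointness moves the outer operator \<open>a\<close> to the test vector, where it can be swapped with \<open>x\<close>.
\<close>

lemma word_rep_perm:
  assumes commuting "mset xs = mset ys" "q \<in> polys_le d"
  shows "L (word_rep xs * q) = L (word_rep ys * q)"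
proof -
  have move: "L (word_rep (as @ x # bs) * q) = L (word_rep (x # as @ bs) * q)"
    if "q \<in> polys_le d" for as x bs q
    using that
  proof (induction as arbitrary: q)
    case (Cons a as)
    let ?w = "word_rep (as @ bs)"
    have "L (word_rep ((a # as) @ x # bs) * q) = L (word_rep (as @ x # bs) * mult_rep a q)"
      using Cons.prems by (simp add: mult_rep_selfadjoint word_rep_polys_le)
    also have "\<dots> = L (mult_rep x ?w * mult_rep a q)"
      using Cons.IH[of "mult_rep a q"] Cons.prems by (simp add: mult_rep_polys_le)
    also have "\<dots> = L (mult_rep a ?w * mult_rep x q)"
      using assms(1) Cons.prems word_rep_polys_le unfolding commuting_def by blast
    also have "\<dots> = L (word_rep (x # (a # as) @ bs) * q)"
      using Cons.prems by (simp add: mult_rep_selfadjoint word_rep_polys_le mult_rep_polys_le)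
    finally show ?case .
  qed simp
  show ?thesis
    using assms(2,3)
  proof (induction xs arbitrary: ys q)
    case (Cons x xs)
    then have "x \<in> set ys"
      by (metis list.set_intros(1) mset_eq_setD)
    then obtain as bs where ys: "ys = as @ x # bs"
      by (meson split_list)
    have "L (word_rep (x # xs) * q) = L (word_rep xs * mult_rep x q)"
      using Cons.prems by (simp add: mult_rep_selfadjoint word_rep_polys_le)
    also have "\<dots> = L (word_rep (as @ bs) * mult_rep x q)"
      using Cons.prems ys by (intro Cons.IH mult_rep_polys_le) auto
    also have "\<dots> = L (word_rep (x # as @ bs) * q)"
      using Cons.prems by (simp add: mult_rep_selfadjoint word_rep_polys_le)
    finally show ?case
      using move[of q as x bs] Cons.prems ys by simp
  qed simp
qed

definition exponent_word :: "('n \<Rightarrow>\<^sub>0 nat) \<Rightarrow> 'n list"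
  where "exponent_word m = (SOME xs. word_exponent xs = m)"

lemma word_exponent_exponent_word [simp]: "word_exponent (exponent_word m) = m"
  unfolding exponent_word_def using ex_word_exponent by (rule someI_ex)

text \<open>
  A representative of \<open>p(M) 1\<close>.  For commuting operators the choice of the word for each monomial is
  immaterial up to the kernel.
\<close>

definition functional_rep :: "'n rpoly \<Rightarrow> 'n rpoly"
  where "functional_rep p = (\<Sum>m\<in>Poly_Mapping.keys p.
    pconst (Poly_Mapping.lookup p m) * word_rep (exponent_word m))"

lemma functional_rep_0 [simp]: "functional_rep 0 = 0"
  by (simp add: functional_rep_def)

lemma functional_rep_add: "functional_rep (p + q) = functional_rep p + functional_rep q"
  unfolding functional_rep_def
  by (rule setsum_keys_plus_distrib) (simp_all add: pconst_add distrib_right)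

lemma functional_rep_diff: "functional_rep (p - q) = functional_rep p - functional_rep q"
  using functional_rep_add[of "p - q" q] by simp

lemma functional_rep_scale: "functional_rep (pconst c * p) = pconst c * functional_rep p"
proof -
  have "functional_rep (pconst c * p) = (\<Sum>m\<in>Poly_Mapping.keys p.
      pconst (c * Poly_Mapping.lookup p m) * word_rep (exponent_word m))"
    unfolding functional_rep_def
    by (intro sum.mono_neutral_cong_left) (auto simp: in_keys_iff)
  then show ?thesis
    by (simp add: functional_rep_def sum_distrib_left mult.assoc flip: pconst_mult)
qed

lemma functional_rep_single:
  "functional_rep (Poly_Mapping.single m c) = pconst c * word_rep (exponent_word m)"
  by (cases "c = 0") (simp_all add: functional_rep_def)

lemma functional_rep_polys_le: "functional_rep p \<in> polys_le d"
  using subset_UNIV[of "Poly_Mapping.keys p"]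
proof (induction p rule: polynomial_support_induct)
  case (monomial m c)
  then show ?case
    by (simp add: functional_rep_single polys_le_pconst_mult word_rep_polys_le)
qed (simp_all add: functional_rep_add polys_le_add)

lemma functional_rep_project:
  assumes "p \<in> polys_le (d + 1)" "q \<in> polys_le d"
  shows "L (functional_rep p * q) = L (p * q)"
  using assms(1) unfolding polys_le_iff
proof (induction p rule: polynomial_support_induct)
  case (monomial m c)
  have "enat (length (exponent_word m)) \<le> d + 1"
    using monomial by (simp flip: mon_degree_word_exponent)
  then have "L (word_rep (exponent_word m) * q) = L (Poly_Mapping.single m 1 * q)"
    using assms(2) word_rep_project[of "exponent_word m" q] by (simp add: prod_pvar_word)
  moreover have "L (Poly_Mapping.single m c * q) = c * L (Poly_Mapping.single m 1 * q)"
    by (subst single_eq_pconst_mult) (rule L_scale_left)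
  ultimately show ?case
    by (simp add: functional_rep_single L_scale_left)
qed (simp_all add: functional_rep_add distrib_right L_add)

lemma functional_rep_kernel:
  assumes "p \<in> polys_le d"
  shows "functional_rep p - p \<in> gns_kernel d L"
  using assms functional_rep_project[OF polys_le_Suc[OF assms]]
  by (intro orthogonal_in_gns_kernel polys_le_diff functional_rep_polys_le)
     (simp_all add: left_diff_distrib L_diff)

text \<open>
  Taking \<open>\<langle>p(M) 1, 1\<rangle>\<close> as the new value at \<open>p\<close>, this is \<open>\<langle>(pq)(M) 1, 1\<rangle> = \<langle>p(M) 1, q(M) 1\<rangle>\<close>.  On monomials it
  says that the word of a product may be replaced by the concatenation of the words, one of them
  reversed, and then split by self-adjointness.
\<close>

lemma functional_rep_mult:
  assumes commuting
  shows "L (functional_rep (p * q)) = L (functional_rep p * functional_rep q)"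
  using subset_UNIV[of "Poly_Mapping.keys p"]
proof (induction p rule: polynomial_support_induct)
  case (monomial m c)
  show ?case
    using subset_UNIV[of "Poly_Mapping.keys q"]
  proof (induction q rule: polynomial_support_induct)
    case (monomial m' c')
    let ?u = "exponent_word m" and ?v = "exponent_word m'"
    have "mset (exponent_word (m + m')) = mset (rev ?u @ ?v)"
      unfolding word_exponent_eq_iff[symmetric]
      by (simp add: word_exponent_append word_exponent_rev)
    then have "L (word_rep (exponent_word (m + m')) * 1) = L (word_rep (rev ?u @ ?v) * 1)"
      using assms by (intro word_rep_perm) simp_all
    then have "L (word_rep (exponent_word (m + m'))) = L (word_rep ?u * word_rep ?v)"
      by (simp add: word_rep_append)
    then show ?case
      by (simp add: mult_single functional_rep_single L_scale L_scale_left L_scale_right)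
  qed (simp_all add: functional_rep_add distrib_left L_add)
qed (simp_all add: functional_rep_add distrib_right L_add)

text \<open>
  In a product \<open>a b\<close> with \<open>a \<in> R\<^sub>d\<^sub>+\<^sub>1\<close> and \<open>b \<in> R\<^sub>d\<close>, the vector \<open>b(M) 1\<close> is the class of \<open>b\<close>, so replacing
  \<open>a(M) 1\<close>, the projection of \<open>a\<close>, by \<open>a\<close> does not change the inner product.  Every
  monomial of degree at most \<open>2d + 1\<close> splits in this way.
\<close>

lemma functional_rep_extends:
  assumes commuting "p \<in> polys_le (2 * d + 1)"
  shows "L (functional_rep p) = L p"
  using assms(2) unfolding polys_le_iff
proof (induction p rule: polynomial_support_induct)
  case (monomial m c)
  obtain zs where zs: "word_exponent zs = m"
    using ex_word_exponent by blast
  have "\<exists>xs ys. zs = xs @ ys \<and> enat (length xs) \<le> d + 1 \<and> enat (length ys) \<le> d"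
  proof (cases d)
    case (enat k)
    have "length zs \<le> 2 * k + 1"
      using monomial zs enat by (auto simp: one_enat_def numeral_eq_enat)
    then show ?thesis
      using enat by (intro exI[of _ "take (k + 1) zs"] exI[of _ "drop (k + 1) zs"])
        (auto simp: one_enat_def)
  qed auto
  then obtain xs ys where split: "zs = xs @ ys" "enat (length xs) \<le> d + 1" "enat (length ys) \<le> d"
    by blast
  define a b :: "'n rpoly"
    where "a = Poly_Mapping.single (word_exponent xs) 1"
      and "b = Poly_Mapping.single (word_exponent ys) 1"
  have a: "a \<in> polys_le (d + 1)" and b: "b \<in> polys_le d"
    using split by (simp_all add: a_def b_def polys_le_single)
  have "L (functional_rep (a * b)) = L (functional_rep a * functional_rep b)"
    by (rule functional_rep_mult[OF assms(1)])
  also have "\<dots> = L (a * functional_rep b)"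
    by (rule functional_rep_project[OF a functional_rep_polys_le])
  also have "\<dots> = L (a * b)"
    using gns_kernelD[OF functional_rep_kernel[OF b] a] by (simp add: algebra_simps L_diff)
  finally have "L (functional_rep (a * b)) = L (a * b)" .
  moreover have "a * b = Poly_Mapping.single m 1"
    using zs split(1) by (auto simp: a_def b_def mult_single word_exponent_def)
  ultimately show ?case
    using single_eq_pconst_mult[of m c] by (simp add: functional_rep_scale L_scale)
qed (simp_all add: functional_rep_add L_add)

text \<open>
  The remainder \<open>p - functional_rep p\<close> is annihilated by the substitution of the operators, because
  \<open>functional_rep\<close> is idempotent modulo the kernel.
\<close>

lemma flat_functional_rep:
  assumes commuting
  shows "flat_form d (\<lambda>p. L (functional_rep p))"
proof -
  let ?U = "gns_kernel d (\<lambda>p. L (functional_rep p))"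
  have remainder: "p - functional_rep p \<in> ?U" if p: "p \<in> polys_le (d + 1)" for p
  proof -
    have "L (functional_rep ((p - functional_rep p) * q)) = 0" for q
    proof -
      have "L ((functional_rep (functional_rep p) - functional_rep p) * functional_rep q) = 0"
        by (intro gns_kernelD functional_rep_kernel functional_rep_polys_le polys_le_Suc)
      then show ?thesis
        by (simp add: functional_rep_mult[OF assms] functional_rep_diff left_diff_distrib L_diff)
    qed
    then show ?thesis
      using p by (simp add: gns_kernel_def polys_le_diff polys_le_Suc functional_rep_polys_le)
  qed
  have "polys_le (d + 1) \<subseteq> polys_le d + ?U"
  proof
    fix p :: "'n rpoly" assume "p \<in> polys_le (d + 1)"
    then have "functional_rep p + (p - functional_rep p) \<in> polys_le d + ?U"
      by (intro set_plus_intro functional_rep_polys_le remainder)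
    then show "p \<in> polys_le d + ?U"
      by simp
  qed
  moreover have "polys_le d + ?U \<subseteq> polys_le (d + 1)"
    by (auto simp: set_plus_def gns_kernel_def intro: polys_le_add polys_le_Suc)
  ultimately show ?thesis
    by (simp add: flat_form_def)
qed

section \<open>Commuting operators from a flat extension\<close>

text \<open>
  Write \<open>X\<^sub>i p = r + u\<close> and \<open>X\<^sub>j q = s + v\<close> with \<open>r, s \<in> R\<^sub>d\<close> and \<open>u, v\<close> in the kernel of \<open>L'\<close>.  Then
  \<open>r\<close> and \<open>s\<close> represent \<open>M\<^sub>i p\<close> and \<open>M\<^sub>j q\<close> for \<open>L\<close>, and their inner product has degree at most \<open>2d\<close>,
  where \<open>L\<close> and \<open>L'\<close> agree; adding back \<open>u\<close> and \<open>v\<close> does not change its value under \<open>L'\<close>.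
\<close>

lemma commuting_if_flat_extension:
  assumes lin: "linear_form_on (2 * d + 2) L'"
    and ext: "\<And>p. p \<in> polys_le (2 * d + 1) \<Longrightarrow> L p = L' p"
    and flat: "flat_form d L'"
  shows commuting
  unfolding commuting_def
proof (intro allI ballI)
  fix i j :: 'n and p q :: "'n rpoly"
  assume p: "p \<in> polys_le d" and q: "q \<in> polys_le d"
  have deg2: "a * b \<in> polys_le (2 * d + 2)" if "a \<in> polys_le (d + 1)" "b \<in> polys_le (d + 1)"
    for a b :: "'n rpoly"
    using that by (rule polys_le_mult_Suc)
  have deg1: "a * b \<in> polys_le (2 * d + 1)" if "a \<in> polys_le (d + 1)" "b \<in> polys_le d"
    for a b :: "'n rpoly"
    using polys_le_mult[OF that] by (simp add: mult_2 add_ac)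
  have L'_add: "L' (a + b) = L' a + L' b" if "a \<in> polys_le (2 * d + 2)" "b \<in> polys_le (2 * d + 2)"
    for a b
    using lin that by (simp add: linear_form_on_def)
  have rep: "\<exists>r\<in>polys_le d. \<exists>u\<in>gns_kernel d L'. pvar i * p = r + u \<and>
      mult_rep i p - r \<in> gns_kernel d L" if p: "p \<in> polys_le d" for i p
  proof -
    obtain r u where ru: "r \<in> polys_le d" "u \<in> gns_kernel d L'" "pvar i * p = r + u"
      using flat polys_le_pvar_mult[OF p, of i] unfolding flat_form_def set_plus_def by blast
    have "L ((mult_rep i p - r) * s) = 0" if s: "s \<in> polys_le d" for s
    proof -
      \<comment> \<open>Here \<open>u s\<close> has degree at most \<open>2d + 1\<close>, so its value can be computed with \<open>L'\<close>.\<close>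
      have "L (u * s) = 0"
        using ru(2) s ext[OF deg1, of u s] by (simp add: gns_kernel_def polys_le_Suc)
      then show ?thesis
        using p s ru(3) by (simp add: left_diff_distrib L_diff mult_rep_inner distrib_right L_add)
    qed
    then have "mult_rep i p - r \<in> gns_kernel d L"
      using p ru(1) by (intro orthogonal_in_gns_kernel polys_le_diff mult_rep_polys_le)
    then show ?thesis
      using ru by blast
  qed
  have key: "L (mult_rep i p * mult_rep j q) = L' (pvar i * p * (pvar j * q))"
    if "p \<in> polys_le d" "q \<in> polys_le d" for i j p q
  proof -
    obtain r u where r: "r \<in> polys_le d" "u \<in> gns_kernel d L'" "pvar i * p = r + u"
        "mult_rep i p - r \<in> gns_kernel d L"
      using rep[OF \<open>p \<in> polys_le d\<close>] by blast
    obtain s v where s: "s \<in> polys_le d" "v \<in> gns_kernel d L'" "pvar j * q = s + v"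
        "mult_rep j q - s \<in> gns_kernel d L"
      using rep[OF \<open>q \<in> polys_le d\<close>] by blast
    have mem: "u \<in> polys_le (d + 1)" "v \<in> polys_le (d + 1)" "r \<in> polys_le (d + 1)"
        "s \<in> polys_le (d + 1)"
      using r s by (simp_all add: gns_kernel_def polys_le_Suc)
    have "L ((mult_rep i p - r) * mult_rep j q) = 0" "L ((mult_rep j q - s) * r) = 0"
      using r s that by (auto intro!: gns_kernelD polys_le_Suc mult_rep_polys_le)
    then have "L (mult_rep i p * mult_rep j q) = L (r * s)"
      by (simp add: algebra_simps L_diff)
    also have "\<dots> = L' (r * s)"
      using mem s by (intro ext deg1)
    also have "\<dots> = L' (r * s + v * r + u * (s + v))"
      using r(2) s(2) mem deg2
      by (simp add: L'_add polys_le_add gns_kernel_def)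
    also have "r * s + v * r + u * (s + v) = pvar i * p * (pvar j * q)"
      unfolding r(3) s(3) by (simp add: algebra_simps)
    finally show ?thesis .
  qed
  have swap: "pvar i * p * (pvar j * q) = pvar j * p * (pvar i * q)"
    by (simp only: mult_ac)
  show "L (mult_rep i p * mult_rep j q) = L (mult_rep j p * mult_rep i q)"
    by (simp only: key[OF p q] swap)
qed

lemma commuting_iff_flat_extension:
  "commuting \<longleftrightarrow>
    (\<exists>L'. linear_form_on (2 * d + 2) L' \<and> (\<forall>p\<in>polys_le (d + 1). L' (p\<^sup>2) \<ge> 0) \<and>
      (\<forall>p\<in>polys_le (2 * d + 1). L p = L' p) \<and> flat_form d L')"
proof
  assume comm: commuting
  have "linear_form_on (2 * d + 2) (\<lambda>p. L (functional_rep p))"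
    by (simp add: linear_form_on_def functional_rep_add functional_rep_scale L_add L_scale)
  moreover have "L (functional_rep (p\<^sup>2)) \<ge> 0" for p
    using L_psd[OF polys_le_Suc[OF functional_rep_polys_le, of p]] functional_rep_mult[OF comm, of p p]
    by (simp add: power2_eq_square)
  ultimately show "\<exists>L'. linear_form_on (2 * d + 2) L' \<and> (\<forall>p\<in>polys_le (d + 1). L' (p\<^sup>2) \<ge> 0) \<and>
      (\<forall>p\<in>polys_le (2 * d + 1). L p = L' p) \<and> flat_form d L'"
    using functional_rep_extends[OF comm] flat_functional_rep[OF comm]
    by (intro exI[of _ "\<lambda>p. L (functional_rep p)"]) simp
next
  assume "\<exists>L'. linear_form_on (2 * d + 2) L' \<and> (\<forall>p\<in>polys_le (d + 1). L' (p\<^sup>2) \<ge> 0) \<and>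
      (\<forall>p\<in>polys_le (2 * d + 1). L p = L' p) \<and> flat_form d L'"
  then show commuting
    by (elim exE conjE) (rule commuting_if_flat_extension; simp)
qed

end

section \<open>Forms given on a bounded degree\<close>

text \<open>
  Monomials of degree above \<open>k\<close> are sent to zero.
\<close>

lemma ex_linear_extension:
  fixes L :: "('n::finite) rpoly \<Rightarrow> real"
  assumes "linear_form_on k L"
  shows "\<exists>L'. (\<forall>p\<in>polys_le k. L' p = L p) \<and> (\<forall>p q. L' (p + q) = L' p + L' q) \<and>
    (\<forall>c p. L' (pconst c * p) = c * L' p)"
proof -
  define L' where "L' = (\<lambda>p :: 'n rpoly. \<Sum>m\<in>Poly_Mapping.keys p. Poly_Mapping.lookup p m *
    (if enat (mon_degree m) \<le> k then L (Poly_Mapping.single m 1) else 0))"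
  have add: "L' (p + q) = L' p + L' q" for p q
    unfolding L'_def by (rule setsum_keys_plus_distrib) (simp_all add: distrib_right)
  have scale: "L' (pconst c * p) = c * L' p" for c p
  proof -
    have "L' (pconst c * p) = (\<Sum>m\<in>Poly_Mapping.keys p. c * Poly_Mapping.lookup p m *
        (if enat (mon_degree m) \<le> k then L (Poly_Mapping.single m 1) else 0))"
      unfolding L'_def by (intro sum.mono_neutral_cong_left) (auto simp: in_keys_iff)
    then show ?thesis
      by (simp add: L'_def sum_distrib_left mult.assoc)
  qed
  have L_scale: "L (pconst c * p) = c * L p" if "p \<in> polys_le k" for c p
    using assms that by (simp add: linear_form_on_def)
  have "L' p = L p" if "p \<in> polys_le k" for p
    using that unfolding polys_le_iff
  proof (induction p rule: polynomial_support_induct)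
    case zero
    show ?case
      using L_scale[of 0 0] by (simp add: L'_def)
  next
    case (monomial m c)
    then have "L' (Poly_Mapping.single m 1) = L (Poly_Mapping.single m 1)"
      by (simp add: L'_def)
    then show ?case
      using monomial scale[of c] L_scale[of "Poly_Mapping.single m 1" c]
      by (simp add: single_eq_pconst_mult[of m c] polys_le_single)
  next
    case (add p q)
    then show ?case
      using assms \<open>\<And>p q. L' (p + q) = L' p + L' q\<close> by (simp add: linear_form_on_def polys_le_iff)
  qed
  then show ?thesis
    using add scale by blast
qed

text \<open>
  All GNS data depend on \<open>L\<close> only through its values at products of two elements of \<open>R\<^sub>d\<^sub>+\<^sub>1\<close>.
\<close>

lemma gns_mult_cong:
  assumes "\<And>p q. p \<in> polys_le (d + 1) \<Longrightarrow> q \<in> polys_le (d + 1) \<Longrightarrow> L (p * q) = L' (p * q)"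
  shows "gns_trunc d L = gns_trunc d L'" "gns_mult d L = gns_mult d L'"
proof -
  have kernel: "gns_kernel d L = gns_kernel d L'"
    using assms by (auto simp: gns_kernel_def)
  have "gns_class d L = gns_class d L'"
    by (simp add: gns_class_def kernel fun_eq_iff)
  moreover from this have "gns_inner d L = gns_inner d L'"
    using assms by (simp add: gns_inner_def fun_eq_iff cong: bex_cong_simp)
  ultimately show "gns_trunc d L = gns_trunc d L'" "gns_mult d L = gns_mult d L'"
    by (simp_all add: gns_trunc_def gns_mult_def gns_proj_def gns_space_def fun_eq_iff)
qed

theorem theorem6p1:
  fixes d :: enat and L :: "('n::finite) rpoly \<Rightarrow> real"
  assumes "linear_form_on (2 * d + 2) L"
    and "\<forall>p\<in>polys_le (d + 1). L (p\<^sup>2) \<ge> 0"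
  shows "(\<forall>i j. \<forall>t\<in>gns_trunc d L.
            gns_mult d L i (gns_mult d L j t) = gns_mult d L j (gns_mult d L i t)) \<longleftrightarrow>
         (\<exists>L' :: 'n rpoly \<Rightarrow> real.
            linear_form_on (2 * d + 2) L' \<and>
            (\<forall>p\<in>polys_le (d + 1). L' (p\<^sup>2) \<ge> 0) \<and>
            (\<forall>p\<in>polys_le (2 * d + 1). L p = L' p) \<and>
            flat_form d L')"
proof -
  obtain K where K: "\<And>p. p \<in> polys_le (2 * d + 2) \<Longrightarrow> K p = L p"
      "\<And>p q. K (p + q) = K p + K q" "\<And>c p. K (pconst c * p) = c * K p"
    using ex_linear_extension[OF assms(1)] by blast
  have mult: "L (p * q) = K (p * q)" if "p \<in> polys_le (d + 1)" "q \<in> polys_le (d + 1)" for p q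
    using that by (intro K(1)[symmetric] polys_le_mult_Suc)
  interpret K: psd_linear_form d K
    by standard (use K assms(2) mult in \<open>auto simp: power2_eq_square\<close>)
  have "L p = K p" if "p \<in> polys_le (2 * d + 1)" for p
    using that by (intro K(1)[symmetric] polys_le_mono[of "2 * d + 1" "2 * d + 2"])
      (auto intro: add_left_mono)
  then have low: "(\<forall>p\<in>polys_le (2 * d + 1). L p = L' p) \<longleftrightarrow>
      (\<forall>p\<in>polys_le (2 * d + 1). K p = L' p)" for L'
    by simp
  have gns: "gns_trunc d L = gns_trunc d K" "gns_mult d L = gns_mult d K"
    by (rule gns_mult_cong; rule mult; assumption)+
  show ?thesis
    unfolding low gns
    by (rule trans[OF K.gns_mult_commute_iff K.commuting_iff_flat_extension])
qed

end
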